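(* Let $m$ be a positive integer. (1) Let $C$ be a binary doubly even self-dual code of length $24m$ with minimum weight $4m$. Then the coefficient of $x^{24m-4m}y^{4m}$ in the weight enumerator of $C$ is divisible by $6$. (2) Let $C$ be a ternary self-dual code of length $12m$ with minimum weight $3m$. Then the coefficient of $x^{12m-3m}y^{3m}$ in the weight enumerator of $C$ is divisible by $4$. (3) Let $C$ be a quaternary self-dual code of length $6m$ with minimum weight $2m$. Then the coefficient of $x^{6m-2m}y^{2m}$ in the weight enumerator of $C$ is divisible by $3$.
   Context: A linear code $C$ of length $n$ over $\mathbb{F}_q$ is a linear subspace of $\mathbb{F}_q^n$. The weight $\mathrm{wt}(x)$ of $x\in\mathbb{F}_q^n$ is the number of its nonzero coordinates; the minimum weight of $C$ is the smallest weight of a nonzero codeword. The weight enumerator of $C$ is $W_C(x,y)=\sum_{c\in C}x^{n-\mathrm{wt}(c)}y^{\mathrm{wt}(c)}$. For $q=2,3$, $C$ is self-dual if $C=C^\perp$ with respect to $(x,y)=\sum_i x_iy_i$; for $q=4$, $C$ is self-dual if it equals its dual with respect to the Hermitian inner product $(x,y)_H=\sum_i x_iy_i^2$. A binary doubly even code is a code over $\mathbb{F}_2$ with all weights divisible by $4$; ternary self-dual codes are self-dual codes over $\mathbb{F}_3$ (all weights are divisible by $3$); quaternary self-dual codes are (Hermitian) self-dual codes over $\mathbb{F}_4$ (all weights are divisible by $2$). *)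

theory Defs
  imports "HOL-Analysis.Analysis" "HOL-Computational_Algebra.Polynomial"
begin

text \<open>
  The ambient space is \<open>'a ^ 'n\<close>, where \<open>'a\<close> is a finite field with \<open>CARD('a) = q\<close> and
  the length of the code is \<open>CARD('n)\<close>.
\<close>

definition linear_code :: "('a::{field,finite} ^ 'n) set \<Rightarrow> bool" where
  "linear_code C \<longleftrightarrow> vec.subspace C"

definition wt :: "'a::zero ^ 'n \<Rightarrow> nat" where
  "wt x = card {i. x $ i \<noteq> 0}"

text \<open>Meaningful only for codes with a nonzero codeword.\<close>

definition min_weight :: "('a::{zero,finite} ^ 'n) set \<Rightarrow> nat" where
  "min_weight C = Min (wt ` (C - {0}))"

definition euclidean_prod :: "'a::field ^ 'n \<Rightarrow> 'a ^ 'n \<Rightarrow> 'a" where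
  "euclidean_prod x y = (\<Sum>i\<in>UNIV. x $ i * y $ i)"

text \<open>Over the field with four elements, squaring is the conjugation.\<close>

definition hermitian_prod :: "'a::field ^ 'n \<Rightarrow> 'a ^ 'n \<Rightarrow> 'a" where
  "hermitian_prod x y = (\<Sum>i\<in>UNIV. x $ i * (y $ i)\<^sup>2)"

definition dual_code ::
  "('a::field ^ 'n \<Rightarrow> 'a ^ 'n \<Rightarrow> 'a) \<Rightarrow> ('a ^ 'n) set \<Rightarrow> ('a ^ 'n) set" where
  "dual_code B C = {x. \<forall>c\<in>C. B x c = 0}"

definition self_dual ::
  "('a::{field,finite} ^ 'n \<Rightarrow> 'a ^ 'n \<Rightarrow> 'a) \<Rightarrow> ('a ^ 'n) set \<Rightarrow> bool" where
  "self_dual B C \<longleftrightarrow> linear_code C \<and> C = dual_code B C"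

definition doubly_even :: "('a::zero ^ 'n) set \<Rightarrow> bool" where
  "doubly_even C \<longleftrightarrow> (\<forall>c\<in>C. 4 dvd wt c)"

text \<open>
  Polynomials in \<open>x\<close> and \<open>y\<close> are elements of \<open>\<int>[y][x]\<close>: the outer variable is \<open>x\<close>, and
  \<open>y\<close> is the variable of the coefficient ring.
\<close>

definition var_x :: "int poly poly" where
  "var_x = monom 1 1"

definition var_y :: "int poly poly" where
  "var_y = [:monom 1 1:]"

definition coeff_xy :: "int poly poly \<Rightarrow> nat \<Rightarrow> nat \<Rightarrow> int" where
  "coeff_xy p i j = coeff (coeff p i) j"

definition weight_enumerator :: "('a::{zero,finite} ^ 'n) set \<Rightarrow> int poly poly" where
  "weight_enumerator C = (\<Sum>c\<in>C. var_x ^ (CARD('n) - wt c) * var_y ^ wt c)"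

end

theory Submission
  imports Defs
begin

text \<open>
  The three divisibilities hold because the codewords of minimum weight \<open>d\<close> form a 1-design: if every
  coordinate is nonzero in the same number \<open>\<lambda>\<close> of them, then counting pairs of a word and one of
  its nonzero coordinates gives \<open>n * \<lambda> = d * A\<close>, where \<open>A\<close> is the required coefficient.
  As \<open>n / d\<close> is \<open>6\<close>, \<open>4\<close>, \<open>3\<close> in the three cases, this is the claim.

  For the design property, fix two coordinates \<open>i\<close>, \<open>j\<close> and weight a codeword by
  \<open>[c\<^sub>i \<noteq> 0] - [c\<^sub>j \<noteq> 0]\<close>. The polynomial \<open>Z(y)\<close> that sums \<open>y ^ (wt c - 1)\<close> over the code with
  these weights is a harmonic weight enumerator of degree one, divided by \<open>y\<close> and with \<open>x = 1\<close>. Up to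
  a nonzero constant it satisfies the MacWilliams identity in degree \<open>n - 2\<close>
  (\<open>diff_enum_macwilliams\<close>), by Poisson summation over the code. The code has no nonzero weight below
  \<open>d\<close>, so \<open>Z\<close> is divisible by \<open>y ^ (d - 1)\<close>, and by the identity also by \<open>(1 - y) ^ (d - 1)\<close>. All
  weights are divisible by \<open>k = 4, 3, 2\<close>, so \<open>Z\<close> is a power of \<open>y\<close> times a polynomial in \<open>y ^ k\<close>,
  and the zero at \<open>1\<close> forces the factor \<open>(y ^ k - 1) ^ (d - 1)\<close>. Comparing degrees leaves

  \<open>Z(y) = (y * (y ^ k - 1)) ^ (d - 1) * s(y ^ k)\<close>

  with \<open>s\<close> constant for \<open>k = 3, 2\<close>, and of degree at most one for \<open>k = 4\<close>, where the all-one word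
  also excludes the weights between \<open>n - d\<close> and \<open>n\<close> (\<open>diff_enum_shape\<close>).
  It remains to see that the identity leaves only \<open>s = 0\<close>. For \<open>q > 2\<close>, the transform vanishes at
  \<open>- 1 / (q - 1)\<close> because there are no words of weight \<open>n - 1\<close>, while the displayed product does
  not (\<open>diff_enum_eq_0_if_length\<close>). For \<open>q = 2\<close>, the factor \<open>y * (y ^ 4 - 1)\<close> is invariant
  under the transform up to a constant, so \<open>s (y ^ 4)\<close> would have to be so too, and no nonzero
  \<open>a + b * y ^ 4\<close> is (\<open>binary_diff_enum_eq_0\<close>).
\<close>

section \<open>Polynomials in a power of the variable\<close>

lemma pcompose_monom_monom:
  "pcompose (monom (a::'a::comm_semiring_1) j) (monom 1 k) = monom a (j * k)"
proof (induction j)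
  case 0
  then show ?case by (simp add: monom_0)
next
  case (Suc j)
  then show ?case by (simp add: monom_Suc pcompose_pCons mult_monom)
qed

lemma pcompose_power:
  "pcompose (p ^ n :: 'a::comm_ring_1 poly) q = pcompose p q ^ n"
  by (induction n) (simp_all add: pcompose_mult pcompose_1)

text \<open>
  The map \<open>y \<mapsto> y ^ k\<close> is unramified at \<open>1\<close>: there \<open>y ^ k - 1\<close> has a simple zero, so substituting
  \<open>y ^ k\<close> leaves the multiplicity of the root \<open>1\<close> unchanged. This spares the other \<open>k\<close>-th roots of
  unity.
\<close>

lemma root_one_multiplicity_of_power:
  fixes r :: "complex poly"
  assumes "k > 0" and "[:-1, 1:] ^ e dvd pcompose r (monom 1 k)"
  shows "[:-1, 1:] ^ e dvd r"
proof (cases "r = 0")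
  case False
  define f where "f = order 1 r"
  obtain s where r: "r = [:-1, 1:] ^ f * s" and "\<not> [:-1, 1:] dvd s"
    using order_decomp[OF False, of 1] unfolding f_def by blast
  then have s1: "poly s 1 \<noteq> 0"
    by (simp add: poly_eq_0_iff_dvd)
  define g :: "complex poly" where "g = (\<Sum>i<k. monom 1 1 ^ i)"
  have "poly g 1 = of_nat k"
    by (simp add: g_def poly_sum poly_monom)
  then have h1: "poly (g ^ f * pcompose s (monom 1 k)) 1 \<noteq> 0"
    using s1 \<open>k > 0\<close> by (simp add: poly_pcompose poly_monom)
  have "pcompose [:-1, 1:] (monom 1 k) = monom 1 1 ^ k - (1 :: complex poly)"
    by (simp add: pcompose_pCons monom_power one_pCons)
  also have "\<dots> = [:-1, 1:] * g"
    unfolding power_diff_1_eq g_def by (simp add: monom_Suc one_pCons monom_0)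
  finally have "pcompose r (monom 1 k) = [:-1, 1:] ^ f * (g ^ f * pcompose s (monom 1 k))"
    by (simp only: r pcompose_mult pcompose_power power_mult_distrib mult.assoc)
  moreover have "[:-1, 1:] ^ f * (g ^ f * pcompose s (monom 1 k)) \<noteq> 0" using h1 by auto
  ultimately have "order 1 (pcompose r (monom 1 k)) = f" and "pcompose r (monom 1 k) \<noteq> 0"
    using order_power_n_n[of 1 f] order_0I[OF h1] order_mult by (metis add.right_neutral)+
  with assms(2) have "e \<le> f"
    using order_divides[of 1 e] by auto
  then show ?thesis
    unfolding f_def using order_divides[of 1 e r] by auto
qed simp

text \<open>
  The exponents \<open>w c - 1\<close> all lie in \<open>d - 1 + k * \<nat>\<close>, so the sum is \<open>y ^ (d - 1) * r (y ^ k)\<close> with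
  \<open>degree r \<le> d - 1 + t\<close>, and the root \<open>1\<close> of multiplicity \<open>d - 1\<close> passes to \<open>r\<close>. The cofactor \<open>s\<close>
  takes the \<open>t\<close> degrees that are left.
\<close>

lemma sparse_poly_with_root_one:
  fixes a :: "'b \<Rightarrow> complex" and w :: "'b \<Rightarrow> nat"
  assumes "finite S" and "k > 0" and "d > 0" and "k dvd d"
    and dvd: "\<And>c. c \<in> S \<Longrightarrow> k dvd w c"
    and lo: "\<And>c. c \<in> S \<Longrightarrow> d \<le> w c"
    and hi: "\<And>c. c \<in> S \<Longrightarrow> w c \<le> d + k * (d - 1 + t)"
    and root: "[:1, -1:] ^ (d - 1) dvd (\<Sum>c\<in>S. smult (a c) (monom 1 (w c - 1)))"
  obtains s where "degree s \<le> t"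
    and "\<And>y. (\<Sum>c\<in>S. a c * y ^ (w c - 1)) = (y * (y ^ k - 1)) ^ (d - 1) * poly s (y ^ k)"
proof -
  define e where "e = d - 1"
  define r where "r = (\<Sum>c\<in>S. smult (a c) (monom 1 ((w c - d) div k)))"
  have w: "w c - 1 = e + (w c - d) div k * k" if "c \<in> S" for c
  proof -
    have "k dvd w c - d"
      using dvd[OF that] \<open>k dvd d\<close> by simp
    then show ?thesis
      using lo[OF that] \<open>d > 0\<close> by (simp add: e_def)
  qed
  have p: "(\<Sum>c\<in>S. smult (a c) (monom 1 (w c - 1))) = monom 1 e * pcompose r (monom 1 k)"
    unfolding r_def pcompose_sum sum_distrib_left pcompose_smult pcompose_monom_monom
    by (intro sum.cong refl) (simp only: w mult_smult_right mult_monom mult_1)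
  have "[:-1, 1:] = - [:1, -1 :: complex:]" by simp
  then have "[:-1, 1 :: complex:] ^ e dvd [:1, -1:] ^ e"
    by (metis dvd_minus_iff dvd_refl dvd_power_same minus_dvd_iff)
  with root have "[:-1, 1:] ^ e dvd monom 1 e * pcompose r (monom 1 k)"
    unfolding p e_def by (rule dvd_trans[rotated])
  moreover have "order 1 (monom (1::complex) e) = 0"
    by (rule order_0I) (simp add: poly_monom)
  ultimately have "[:-1, 1:] ^ e dvd pcompose r (monom 1 k)"
    using order_divides[of 1 e "monom 1 e * pcompose r (monom 1 k)"]
      order_divides[of 1 e "pcompose r (monom 1 k)"]
    by (auto simp: order_mult)
  then have "[:-1, 1:] ^ e dvd r"
    by (rule root_one_multiplicity_of_power[OF \<open>k > 0\<close>])
  then obtain s where s: "r = [:-1, 1:] ^ e * s" ..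
  have "degree r \<le> e + t"
    unfolding r_def
  proof (rule degree_sum_le[OF \<open>finite S\<close>])
    fix c assume "c \<in> S"
    have "(w c - d) div k \<le> (k * (e + t)) div k"
      using hi[OF \<open>c \<in> S\<close>] by (intro div_le_mono) (simp add: e_def)
    then have "(w c - d) div k \<le> e + t"
      using \<open>k > 0\<close> by simp
    then show "degree (smult (a c) (monom 1 ((w c - d) div k))) \<le> e + t"
      using degree_monom_le[of "1::complex"] degree_smult_le le_trans by blast
  qed
  then have deg: "degree s \<le> t"
    unfolding s by (cases "s = 0") (simp_all add: degree_mult_eq degree_power_eq)
  have "(\<Sum>c\<in>S. a c * y ^ (w c - 1)) = (y * (y ^ k - 1)) ^ (d - 1) * poly s (y ^ k)" for y
  proof -
    have "(\<Sum>c\<in>S. a c * y ^ (w c - 1)) = poly (\<Sum>c\<in>S. smult (a c) (monom 1 (w c - 1))) y"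
      by (simp add: poly_sum poly_monom)
    also have "\<dots> = y ^ e * poly r (y ^ k)"
      by (simp only: p poly_mult poly_pcompose) (simp add: poly_monom)
    finally show ?thesis
      by (simp add: s e_def power_mult_distrib)
  qed
  with deg show ?thesis by (rule that)
qed

section \<open>Additive characters and Poisson summation\<close>

lemma sum_character_eq_0:
  fixes h :: "'b::ab_group_add \<Rightarrow> complex"
  assumes "finite A" "a \<in> A" and closed: "\<And>x. x \<in> A \<Longrightarrow> a + x \<in> A"
    and h: "\<And>x. x \<in> A \<Longrightarrow> h (a + x) = h a * h x" and "h a \<noteq> 1"
  shows "sum h A = 0"
proof -
  have "(+) a ` A = A"
    by (rule endo_inj_surj) (use assms in auto)
  then have "sum h A = (\<Sum>x\<in>A. h (a + x))"
    using sum.reindex[of "(+) a" A h] by simp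
  also have "\<dots> = h a * sum h A"
    by (simp add: h sum_distrib_left)
  finally show ?thesis
    using \<open>h a \<noteq> 1\<close> by simp
qed

lemma sum_prod_coordinates:
  fixes g :: "'n::finite \<Rightarrow> 'a::finite \<Rightarrow> 'c::comm_semiring_1"
  shows "(\<Sum>u\<in>UNIV. \<Prod>l\<in>UNIV. g l (u $ l)) = (\<Prod>l\<in>UNIV. \<Sum>v\<in>UNIV. g l v)"
proof -
  have "(\<Prod>l\<in>UNIV. \<Sum>v\<in>UNIV. g l v) = (\<Sum>f\<in>PiE UNIV (\<lambda>_. UNIV). \<Prod>l\<in>UNIV. g l (f l))"
    by (rule prod_sum_PiE) auto
  also have "\<dots> = (\<Sum>u\<in>UNIV. \<Prod>l\<in>UNIV. g l (u $ l))"
    by (rule sum.reindex_bij_witness[of _ vec_nth vec_lambda]) auto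
  finally show ?thesis ..
qed

text \<open>
  The supports of the words of a given weight, counted with multiplicity, form a 1-design exactly when
  these values sum to zero over those words for all \<open>i\<close> and \<open>j\<close>.
\<close>

definition coord_diff :: "'n \<Rightarrow> 'n \<Rightarrow> 'a::zero ^ 'n \<Rightarrow> complex" where
  "coord_diff i j c = of_bool (c $ i \<noteq> 0) - of_bool (c $ j \<noteq> 0)"

lemma coord_diff_nonzero_wt:
  fixes c :: "'a::zero ^ 'n"
  assumes "coord_diff i j c \<noteq> 0"
  shows "0 < wt c" and "wt c < CARD('n)"
proof -
  have "{l. c $ l \<noteq> 0} \<noteq> {}" "{l. c $ l \<noteq> 0} \<noteq> UNIV"
    using assms by (auto simp: coord_diff_def of_bool_def split: if_splits)
  then show "0 < wt c" and "wt c < CARD('n)"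
    by (auto simp: wt_def card_gt_0_iff intro!: psubset_card_mono)
qed

section \<open>The MacWilliams identity in degree one\<close>

text \<open>
  The field automorphism \<open>\<sigma>\<close> is the identity for Euclidean duality and squaring for Hermitian
  duality over the field with four elements. The nontrivial additive character \<open>\<psi>\<close> is a
  parameter so that each of the three small fields can supply an explicit one.
\<close>

locale conjugate_self_dual_code =
  fixes C :: "('a::{field,finite} ^ 'n) set" and \<sigma> :: "'a \<Rightarrow> 'a" and \<psi> :: "'a \<Rightarrow> complex"
  assumes subspace: "vec.subspace C"
    and self_dual: "C = dual_code (\<lambda>x y. \<Sum>i\<in>UNIV. x $ i * \<sigma> (y $ i)) C"
    and \<sigma>_add: "\<sigma> (a + b) = \<sigma> a + \<sigma> b"
    and \<sigma>_mult: "\<sigma> (a * b) = \<sigma> a * \<sigma> b"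
    and \<sigma>_bij: "bij \<sigma>"
    and \<psi>_zero: "\<psi> 0 = 1"
    and \<psi>_add: "\<psi> (a + b) = \<psi> a * \<psi> b"
    and \<psi>_nontrivial: "\<exists>a. \<psi> a \<noteq> 1"
begin

definition pairing :: "'a ^ 'n \<Rightarrow> 'a ^ 'n \<Rightarrow> 'a" where
  "pairing u c = (\<Sum>i\<in>UNIV. u $ i * \<sigma> (c $ i))"

lemma \<sigma>_zero: "\<sigma> 0 = 0"
proof -
  have "\<sigma> 0 + 0 = \<sigma> 0 + \<sigma> 0"
    by (simp flip: \<sigma>_add)
  then show ?thesis by (simp only: add_left_cancel)
qed

lemma \<sigma>_eq_0_iff: "\<sigma> a = 0 \<longleftrightarrow> a = 0"
  using \<sigma>_bij \<sigma>_zero by (metis bij_def injD)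

lemma mem_code_iff: "u \<in> C \<longleftrightarrow> (\<forall>c\<in>C. pairing u c = 0)"
  by (subst self_dual) (simp add: dual_code_def pairing_def)

lemma pairing_add: "pairing u (b + c) = pairing u b + pairing u c"
  by (simp add: pairing_def \<sigma>_add distrib_left sum.distrib)

lemma pairing_scale: "pairing u (a *s c) = \<sigma> a * pairing u c"
  by (simp add: pairing_def \<sigma>_mult sum_distrib_left mult_ac)

lemma sum_character: "(\<Sum>a\<in>UNIV. \<psi> a) = 0"
proof -
  obtain a where "\<psi> a \<noteq> 1" using \<psi>_nontrivial ..
  then show ?thesis
    by (intro sum_character_eq_0[of UNIV a]) (simp_all add: \<psi>_add)
qed

text \<open>
  Orthogonality over \<open>C\<close>. For \<open>u\<close> outside the code some \<open>pairing u c\<close> is nonzero, and rescaling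
  \<open>c\<close>, for which \<open>\<sigma>\<close> must be onto, moves this value to a point where \<open>\<psi>\<close> is not \<open>1\<close>.
\<close>

lemma character_sum_over_code: "(\<Sum>c\<in>C. \<psi> (pairing u c)) = (if u \<in> C then of_nat (card C) else 0)"
proof (cases "u \<in> C")
  case True
  then have "\<psi> (pairing u c) = 1" if "c \<in> C" for c
    using that mem_code_iff[of u] by (auto simp: \<psi>_zero)
  with True show ?thesis by simp
next
  case False
  then obtain c where c: "c \<in> C" "pairing u c \<noteq> 0"
    using mem_code_iff[of u] by blast
  obtain a where a: "\<psi> a \<noteq> 1" using \<psi>_nontrivial ..
  obtain b where b: "\<sigma> b = a / pairing u c"
    using \<sigma>_bij by (metis bij_pointE)
  have bc: "b *s c \<in> C"
    using subspace c vec.subspace_scale by blast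
  have "pairing u (b *s c) = a"
    using c b by (simp add: pairing_scale)
  then have "(\<Sum>c\<in>C. \<psi> (pairing u c)) = 0"
    using bc a subspace
    by (intro sum_character_eq_0[of _ "b *s c"]) (auto simp: pairing_add \<psi>_add vec.subspace_add)
  with False show ?thesis by simp
qed

lemma poisson_summation:
  "of_nat (card C) * (\<Sum>u\<in>C. F u) = (\<Sum>c\<in>C. \<Sum>u\<in>UNIV. F u * \<psi> (pairing u c))"
proof -
  have "(\<Sum>c\<in>C. \<Sum>u\<in>UNIV. F u * \<psi> (pairing u c)) = (\<Sum>u\<in>UNIV. F u * (\<Sum>c\<in>C. \<psi> (pairing u c)))"
    by (subst sum.swap) (simp add: sum_distrib_left)
  also have "\<dots> = (\<Sum>u\<in>UNIV. if u \<in> C then F u * of_nat (card C) else 0)"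
    by (intro sum.cong) (auto simp: character_sum_over_code)
  also have "\<dots> = (\<Sum>u\<in>C. F u * of_nat (card C))"
    by (simp add: sum.If_cases)
  finally show ?thesis by (simp only: sum_distrib_right[symmetric] mult.commute)
qed

lemma \<psi>_sum: "finite A \<Longrightarrow> \<psi> (sum f A) = (\<Prod>x\<in>A. \<psi> (f x))"
  by (induction A rule: finite_induct) (auto simp: \<psi>_zero \<psi>_add)

lemma local_transform:
  fixes x y :: complex
  shows "(\<Sum>v\<in>UNIV. (if v = 0 then x else y) * \<psi> (v * s))
    = (if s = 0 then x + of_nat (CARD('a) - 1) * y else x - y)"
proof -
  have split: "(\<Sum>v\<in>UNIV. f v) = f 0 + (\<Sum>v\<in>UNIV - {0}. f v)" for f :: "'a \<Rightarrow> complex"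
    by (rule sum.remove) auto
  have nz: "(\<Sum>v\<in>UNIV. (if v = 0 then x else y) * \<psi> (v * s)) = x + y * (\<Sum>v\<in>UNIV - {0}. \<psi> (v * s))"
    by (subst split) (simp add: \<psi>_zero sum_distrib_left)
  show ?thesis
  proof (cases "s = 0")
    case True
    have "(\<Sum>v\<in>UNIV. (if v = 0 then x else y) * \<psi> (v * s)) = x + y * (\<Sum>v\<in>UNIV - {0::'a}. 1)"
      unfolding nz by (simp add: True \<psi>_zero)
    with True show ?thesis by (simp only: sum_constant card_Diff_singleton UNIV_I) simp
  next
    case False
    have "(\<Sum>v\<in>UNIV. \<psi> (v * s)) = (\<Sum>a\<in>UNIV. \<psi> a)"
      by (rule sum.reindex_bij_witness[of _ "\<lambda>a. a / s" "\<lambda>v. v * s"]) (use False in auto)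
    then have "1 + (\<Sum>v\<in>UNIV - {0}. \<psi> (v * s)) = 0"
      using split[of "\<lambda>v. \<psi> (v * s)"] by (simp add: sum_character \<psi>_zero)
    then have "(\<Sum>v\<in>UNIV - {0}. \<psi> (v * s)) = -1"
      by (simp add: eq_neg_iff_add_eq_0 add.commute)
    with False show ?thesis by (simp add: nz)
  qed
qed

text \<open>
  For \<open>x = 1\<close>, summing this over the code enumerates the codewords that are nonzero at \<open>i\<close>. As a
  product of one factor for each coordinate it has a computable transform.
\<close>

definition marked :: "'n \<Rightarrow> complex \<Rightarrow> 'a ^ 'n \<Rightarrow> complex" where
  "marked i y u = of_bool (u $ i \<noteq> 0) * y ^ wt u"

lemma prod_by_support:
  fixes c :: "'a ^ 'n" and P Q :: complex
  shows "(\<Prod>l\<in>UNIV - {i}. if c $ l = 0 then P else Q)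
    = (if c $ i = 0 then P ^ (CARD('n) - 1 - wt c) * Q ^ wt c
       else P ^ (CARD('n) - wt c) * Q ^ (wt c - 1))"
proof -
  let ?S = "{l. c $ l \<noteq> 0}"
  have "(\<Prod>l\<in>UNIV - {i}. if c $ l = 0 then P else Q)
      = P ^ card (UNIV - {i} - ?S) * Q ^ card ((UNIV - {i}) \<inter> ?S)"
    by (simp add: prod.If_cases Diff_eq Collect_neg_eq)
  also have "(UNIV - {i}) \<inter> ?S = ?S - {i}" by auto
  also have "card (?S - {i}) = (if c $ i = 0 then wt c else wt c - 1)"
    by (auto simp: wt_def card_Diff_singleton_if)
  also have "card (UNIV - {i} - ?S) = (if c $ i = 0 then CARD('n) - 1 - wt c else CARD('n) - wt c)"
  proof (cases "c $ i = 0")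
    case True
    then have "?S \<subseteq> UNIV - {i}" by auto
    with True show ?thesis by (simp add: card_Diff_subset wt_def card_Diff_singleton)
  next
    case False
    then have "UNIV - {i} - ?S = UNIV - ?S" by auto
    with False show ?thesis by (simp add: card_Diff_subset wt_def)
  qed
  finally show ?thesis by simp
qed

lemma marked_transform:
  fixes y :: complex
  defines "q \<equiv> of_nat CARD('a)"
  defines "P \<equiv> 1 + (q - 1) * y" and "Q \<equiv> 1 - y"
  shows "(\<Sum>u\<in>UNIV. marked i y u * \<psi> (pairing u c))
    = (if c $ i = 0 then (q - 1) * y * P ^ (CARD('n) - 1 - wt c) * Q ^ wt c
       else - y * P ^ (CARD('n) - wt c) * Q ^ (wt c - 1))"
proof -
  \<comment> \<open>The local value at a zero entry is \<open>1\<close>, except \<open>0\<close> at \<open>i\<close>, which excludes \<open>u $ i = 0\<close>.\<close>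
  let ?x = "\<lambda>l. of_bool (l \<noteq> i) :: complex"
  let ?g = "\<lambda>l v. (if v = 0 then ?x l else y) * \<psi> (v * \<sigma> (c $ l))"
  have q: "of_nat (CARD('a) - 1) = q - 1"
    by (simp add: q_def of_nat_diff)
  have "y ^ wt u = (\<Prod>l\<in>UNIV. if u $ l = 0 then 1 else y)" for u :: "'a ^ 'n"
    by (simp add: wt_def prod.If_cases Collect_neg_eq)
  moreover have "of_bool (u $ i \<noteq> 0) = (\<Prod>l\<in>UNIV. if u $ l = 0 then ?x l else 1)" for u :: "'a ^ 'n"
  proof (cases "u $ i = 0")
    case True
    then show ?thesis by (auto intro!: prod_zero[symmetric] bexI[of _ i])
  next
    case False
    then have "(\<Prod>l\<in>UNIV. if u $ l = 0 then ?x l else 1) = 1"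
      by (intro prod.neutral) auto
    with False show ?thesis by simp
  qed
  ultimately have "marked i y u = (\<Prod>l\<in>UNIV. if u $ l = 0 then ?x l else y)" for u :: "'a ^ 'n"
    unfolding marked_def by (simp only: prod.distrib[symmetric]) (auto intro!: prod.cong)
  then have "marked i y u * \<psi> (pairing u c) = (\<Prod>l\<in>UNIV. ?g l (u $ l))" for u
    by (simp add: pairing_def \<psi>_sum prod.distrib)
  then have "(\<Sum>u\<in>UNIV. marked i y u * \<psi> (pairing u c)) = (\<Sum>u\<in>UNIV. \<Prod>l\<in>UNIV. ?g l (u $ l))"
    by simp
  also have "\<dots> = (\<Prod>l\<in>UNIV. \<Sum>v\<in>UNIV. ?g l v)"
    by (rule sum_prod_coordinates)
  also have "\<dots> = (\<Prod>l\<in>UNIV. if c $ l = 0 then ?x l + (q - 1) * y else ?x l - y)"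
    by (simp only: local_transform \<sigma>_eq_0_iff q)
  also have "\<dots> = (if c $ i = 0 then (q - 1) * y else - y)
      * (\<Prod>l\<in>UNIV - {i}. if c $ l = 0 then ?x l + (q - 1) * y else ?x l - y)"
    by (subst prod.remove[of _ i]) auto
  also have "(\<Prod>l\<in>UNIV - {i}. if c $ l = 0 then ?x l + (q - 1) * y else ?x l - y)
      = (\<Prod>l\<in>UNIV - {i}. if c $ l = 0 then P else Q)"
    by (rule prod.cong) (auto simp: P_def Q_def)
  finally show ?thesis
    by (simp add: prod_by_support)
qed

text \<open>
  The harmonic weight enumerator of degree one for \<open>e\<^sub>i - e\<^sub>j\<close>, divided by \<open>y\<close> and dehomogenized by
  \<open>x = 1\<close>. The zero word gets coefficient \<open>0\<close>, so the truncated exponent does no harm.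
\<close>

definition diff_enum :: "'n \<Rightarrow> 'n \<Rightarrow> complex poly" where
  "diff_enum i j = (\<Sum>c\<in>C. smult (coord_diff i j c) (monom 1 (wt c - 1)))"

text \<open>
  Poisson summation for \<open>marked i y - marked j y\<close>. A codeword contributes to the transformed side
  only if exactly one of its entries at \<open>i\<close> and \<open>j\<close> is zero, and then its two contributions differ
  by a monomial in \<open>P = 1 + (q - 1) * y\<close> and \<open>Q = 1 - y\<close> times \<open>P + (q - 1) * Q = q\<close>. Both sides of
  the summation carry a factor \<open>y\<close>; cancelling it gives the identity for \<open>y \<noteq> 0\<close>, hence for
  polynomials.
\<close>

theorem diff_enum_macwilliams:
  defines "q \<equiv> of_nat CARD('a)"
  shows "smult (of_nat (card C)) (diff_enum i j) = smult (- q) (\<Sum>c\<in>C. smult (coord_diff i j c)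
    ([:1, q - 1:] ^ (CARD('n) - 1 - wt c) * [:1, -1:] ^ (wt c - 1)))" (is "?L = ?R")
proof -
  let ?n = "CARD('n)"
  define L R where "L = ?L" and "R = ?R"
  define P Q where "P = (\<lambda>y. 1 + (q - 1) * y)" and "Q = (\<lambda>y::complex. 1 - y)"
  have L: "poly L y = of_nat (card C) * (\<Sum>c\<in>C. coord_diff i j c * y ^ (wt c - 1))" for y
    by (simp add: L_def diff_enum_def poly_sum poly_monom)
  have R: "poly R y = - q * (\<Sum>c\<in>C. coord_diff i j c * (P y ^ (?n - 1 - wt c) * Q y ^ (wt c - 1)))" for y
    by (simp add: R_def poly_sum P_def Q_def algebra_simps)
  have eq: "poly L y = poly R y" if "y \<noteq> 0" for y
  proof -
    define T where "T i c = (\<Sum>u\<in>UNIV. marked i y u * \<psi> (pairing u c))" for i c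
    have left: "marked i y c - marked j y c = y * (coord_diff i j c * y ^ (wt c - 1))" for c :: "'a ^ 'n"
    proof (cases "coord_diff i j c = 0")
      case True
      then show ?thesis by (simp add: marked_def coord_diff_def left_diff_distrib[symmetric])
    next
      case False
      then have "y ^ wt c = y * y ^ (wt c - 1)"
        using coord_diff_nonzero_wt(1)[OF False] by (simp add: power_eq_if)
      then show ?thesis by (simp add: marked_def coord_diff_def algebra_simps)
    qed
    have right: "T i c - T j c
      = y * (- q * (coord_diff i j c * (P y ^ (?n - 1 - wt c) * Q y ^ (wt c - 1))))" for c
    proof (cases "coord_diff i j c = 0")
      case True
      then show ?thesis
        by (auto simp: T_def marked_transform coord_diff_def of_bool_def split: if_splits)
    next
      case False
      note wt = coord_diff_nonzero_wt[OF False]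
      have "?n - wt c = Suc (?n - 1 - wt c)" and "wt c = Suc (wt c - 1)"
        using wt by simp_all
      then have 1: "P y ^ (?n - wt c) = P y * P y ^ (?n - 1 - wt c)"
        and 2: "Q y ^ wt c = Q y * Q y ^ (wt c - 1)"
        by (metis power_Suc)+
      have 3: "(q - 1) * Q y = q - P y"
        by (simp add: P_def Q_def algebra_simps)
      define p r where "p = P y ^ (?n - 1 - wt c)" and "r = Q y ^ (wt c - 1)"
      have PQ: "1 + (q - 1) * y = P y" "1 - y = Q y"
        by (simp_all add: P_def Q_def)
      have T: "T l c = (if c $ l = 0 then (q - 1) * y * p * (Q y * r) else - y * (P y * p) * r)" for l
        unfolding T_def marked_transform q_def[symmetric]
        by (simp only: PQ 1 2 p_def r_def)
      have 4: "(q - 1) * y * p * (Q y * r) = y * (q - P y) * p * r"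
        by (simp add: 3[symmetric] mult_ac)
      show ?thesis
        unfolding T 4 p_def[symmetric] r_def[symmetric]
        using False by (auto simp: coord_diff_def algebra_simps)
    qed
    have "y * poly L y = of_nat (card C) * (\<Sum>c\<in>C. marked i y c - marked j y c)"
      by (simp add: left L sum_distrib_left mult_ac)
    also have "\<dots> = (\<Sum>c\<in>C. T i c - T j c)"
      unfolding T_def sum_subtractf right_diff_distrib poisson_summation ..
    also have "\<dots> = y * poly R y"
      by (simp add: right R sum_distrib_left)
    finally show ?thesis using that by simp
  qed
  have "L = R"
  proof (rule ccontr)
    assume "L \<noteq> R"
    then have "finite {y. poly (L - R) y = 0}"
      by (intro poly_roots_finite) simp
    moreover have "UNIV - {0} \<subseteq> {y. poly (L - R) y = 0}"
      using eq by auto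
    ultimately have "finite (UNIV - {0 :: complex})"
      by (rule rev_finite_subset)
    then show False
      using infinite_UNIV_char_0[where 'a = complex] by simp
  qed
  then show ?thesis by (simp only: L_def R_def)
qed

lemma poly_diff_enum_macwilliams:
  fixes y :: complex
  defines "q \<equiv> of_nat CARD('a)"
  shows "of_nat (card C) * poly (diff_enum i j) y = - q * (\<Sum>c\<in>C. coord_diff i j c
    * ((1 + (q - 1) * y) ^ (CARD('n) - 1 - wt c) * (1 - y) ^ (wt c - 1)))"
  using arg_cong[OF diff_enum_macwilliams, of "\<lambda>p. poly p y" i j]
  by (simp add: q_def poly_sum mult.commute[of y])

section \<open>Vanishing of the harmonic weight enumerator\<close>

lemma code_nonempty: "C \<noteq> {}"
  using subspace vec.subspace_0 by blast

text \<open>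
  The words that contribute have weight at least \<open>d\<close>, so on the transformed side of the identity
  every term has the factor \<open>(1 - y) ^ (d - 1)\<close>.
\<close>

lemma diff_enum_shape:
  assumes "k > 0" and "d > 0" and "k dvd d"
    and dvd: "\<And>c. c \<in> C \<Longrightarrow> k dvd wt c"
    and bounds: "\<And>c. c \<in> C \<Longrightarrow> coord_diff i j c \<noteq> 0 \<Longrightarrow> d \<le> wt c \<and> wt c \<le> d + k * (d - 1 + t)"
  obtains s where "degree s \<le> t"
    and "\<And>y. poly (diff_enum i j) y = (y * (y ^ k - 1)) ^ (d - 1) * poly s (y ^ k)"
proof -
  define S where "S = {c \<in> C. coord_diff i j c \<noteq> 0}"
  have enum: "diff_enum i j = (\<Sum>c\<in>S. smult (coord_diff i j c) (monom 1 (wt c - 1)))"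
    unfolding diff_enum_def S_def by (rule sum.mono_neutral_right) auto
  have "[:1, -1:] ^ (d - 1) dvd smult (of_nat (card C)) (diff_enum i j)"
    unfolding diff_enum_macwilliams
  proof (rule dvd_smult, rule dvd_sum)
    fix c assume "c \<in> C"
    show "[:1, -1:] ^ (d - 1) dvd smult (coord_diff i j c)
      ([:1, of_nat CARD('a) - 1:] ^ (CARD('n) - 1 - wt c) * [:1, -1:] ^ (wt c - 1))"
    proof (cases "coord_diff i j c = 0")
      case False
      with \<open>c \<in> C\<close> bounds have "d - 1 \<le> wt c - 1" by (simp add: diff_le_mono)
      then show ?thesis by (intro dvd_smult dvd_mult le_imp_power_dvd)
    qed simp
  qed
  then have "[:1, -1:] ^ (d - 1) dvd diff_enum i j"
    using code_nonempty by (simp add: dvd_smult_iff)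
  then obtain s where "degree s \<le> t"
    and "\<And>y. (\<Sum>c\<in>S. coord_diff i j c * y ^ (wt c - 1)) = (y * (y ^ k - 1)) ^ (d - 1) * poly s (y ^ k)"
    using sparse_poly_with_root_one[of S k d wt t "coord_diff i j"] assms
    unfolding enum by (auto simp: S_def)
  then show ?thesis
    by (intro that[of s]) (simp_all add: enum poly_sum poly_monom)
qed

text \<open>
  This length leaves a constant cofactor, since a contributing word has weight at most \<open>n - k\<close>. To see
  that the constant is zero, evaluate the identity at the zero of \<open>1 + (q - 1) * y\<close>: that factor
  occurs in every term, as no word has weight \<open>n - 1\<close>, and for \<open>q > 2\<close> the point is not a root of
  \<open>y * (y ^ k - 1)\<close>. For \<open>q = 2\<close> it is the root \<open>-1\<close> whenever \<open>k\<close> is even.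
\<close>

lemma diff_enum_eq_0_if_length:
  assumes "CARD('a) > 2" and "k \<ge> 2" and "d > 0" and "k dvd d" and len: "CARD('n) = (k + 1) * d"
    and dvd: "\<And>c. c \<in> C \<Longrightarrow> k dvd wt c"
    and min: "\<And>c. c \<in> C \<Longrightarrow> c \<noteq> 0 \<Longrightarrow> d \<le> wt c"
  shows "diff_enum i j = 0"
proof -
  have high: "wt c + k \<le> CARD('n)" if "c \<in> C" "coord_diff i j c \<noteq> 0" for c
  proof -
    have "k dvd CARD('n) - wt c"
      using dvd[OF that(1)] \<open>k dvd d\<close> by (simp add: len)
    moreover have "wt c < CARD('n)" by (rule coord_diff_nonzero_wt[OF that(2)])
    ultimately show ?thesis using dvd_imp_le[of k "CARD('n) - wt c"] by simp
  qed
  have bounds: "d \<le> wt c \<and> wt c \<le> d + k * (d - 1 + 0)" if "c \<in> C" "coord_diff i j c \<noteq> 0" for c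
  proof
    from that(2) have "c \<noteq> 0" by (auto simp: coord_diff_def)
    with that(1) show "d \<le> wt c" by (rule min)
    show "wt c \<le> d + k * (d - 1 + 0)"
      using high[OF that] \<open>d > 0\<close> by (cases d) (auto simp: len algebra_simps)
  qed
  obtain s where s: "degree s \<le> 0"
    "\<And>y. poly (diff_enum i j) y = (y * (y ^ k - 1)) ^ (d - 1) * poly s (y ^ k)"
    using diff_enum_shape[OF _ \<open>d > 0\<close> \<open>k dvd d\<close> dvd bounds] \<open>k \<ge> 2\<close> by auto
  obtain a where a: "s = [:a:]"
    using s(1) degree_eq_zeroE by blast
  define q :: complex where "q = of_nat CARD('a)"
  define y where "y = - 1 / (q - 1)"
  have "q - 1 = of_nat (CARD('a) - 1)"
    by (simp add: q_def of_nat_diff)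
  then have norm: "norm (q - 1) = real (CARD('a) - 1)"
    by (simp only: norm_of_nat)
  then have "q - 1 \<noteq> 0" using \<open>CARD('a) > 2\<close> by auto
  then have y0: "y \<noteq> 0" and yq: "1 + (q - 1) * y = 0"
    by (simp_all add: y_def)
  have "norm y < 1"
    using norm \<open>CARD('a) > 2\<close> by (simp add: y_def norm_divide)
  then have "norm (y ^ k) < 1"
    using \<open>k \<ge> 2\<close> by (simp add: norm_power power_less_one_iff)
  then have yk: "y ^ k \<noteq> 1" by auto
  have "coord_diff i j c * ((1 + (q - 1) * y) ^ (CARD('n) - 1 - wt c) * (1 - y) ^ (wt c - 1)) = 0"
    if "c \<in> C" for c
  proof (cases "coord_diff i j c = 0")
    case False
    then have "CARD('n) - 1 - wt c > 0"
      using high[OF that] \<open>k \<ge> 2\<close> by simp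
    then show ?thesis by (simp add: yq)
  qed simp
  then have "(\<Sum>c\<in>C. coord_diff i j c
      * ((1 + (q - 1) * y) ^ (CARD('n) - 1 - wt c) * (1 - y) ^ (wt c - 1))) = 0"
    by (rule sum.neutral[OF ballI])
  then have "of_nat (card C) * poly (diff_enum i j) y = 0"
    unfolding poly_diff_enum_macwilliams q_def[symmetric] by simp
  then have "poly (diff_enum i j) y = 0"
    using code_nonempty by simp
  then have "a = 0"
    using y0 yk by (simp add: s(2) a)
  then have "poly (diff_enum i j) = poly 0"
    by (auto simp: s(2) a)
  then show ?thesis by (simp only: poly_eq_poly_eq_iff)
qed

text \<open>
  Here the upper bound on the weights leaves a cofactor \<open>a + b * y ^ 4\<close>. The substitution
  \<open>z = (1 - y) / (1 + y)\<close> turns the transformed side into \<open>(1 + y) ^ (n - 2)\<close> times the value at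
  \<open>z\<close>, and maps \<open>y * (y ^ 4 - 1)\<close>, as a form of degree six, to \<open>8\<close> times itself. The cofactor, as a
  form of degree four, would then be a multiple of its own transform, which three values of \<open>y\<close>
  exclude.
\<close>

lemma binary_diff_enum_eq_0:
  assumes "CARD('a) = 2" and "d > 0" and "4 dvd d" and len: "CARD('n) = 6 * d"
    and dvd: "\<And>c. c \<in> C \<Longrightarrow> 4 dvd wt c"
    and weights: "\<And>c. c \<in> C \<Longrightarrow> c \<noteq> 0 \<Longrightarrow> wt c < CARD('n) \<Longrightarrow> d \<le> wt c \<and> wt c \<le> CARD('n) - d"
  shows "diff_enum i j = 0"
proof -
  define e where "e = d - 1"
  have d: "d = e + 1" using \<open>d > 0\<close> by (simp add: e_def)
  have bounds: "d \<le> wt c \<and> wt c \<le> d + 4 * (d - 1 + 1)" if "c \<in> C" "coord_diff i j c \<noteq> 0" for c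
  proof -
    have "c \<noteq> 0" using that(2) by (auto simp: coord_diff_def)
    with weights[OF that(1)] coord_diff_nonzero_wt(2)[OF that(2)] \<open>d > 0\<close> show ?thesis
      by (simp add: len)
  qed
  obtain s where s: "degree s \<le> 1"
    "\<And>y. poly (diff_enum i j) y = (y * (y ^ 4 - 1)) ^ e * poly s (y ^ 4)"
    using diff_enum_shape[OF _ \<open>d > 0\<close> \<open>4 dvd d\<close> dvd bounds] unfolding e_def by auto
  define a b where "a = coeff s 0" and "b = coeff s 1"
  have ab: "s = [:a, b:]"
    using s(1) by (intro poly_eqI) (auto simp: a_def b_def coeff_pCons coeff_eq_0 split: nat.split)
  define \<kappa> :: complex where "\<kappa> = - (2 * 8 ^ e) / of_nat (card C)"
  have \<kappa>: "\<kappa> \<noteq> 0" using code_nonempty by (simp add: \<kappa>_def)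
  have eq: "a + b * y ^ 4 = \<kappa> * (a * (1 + y) ^ 4 + b * (1 - y) ^ 4)"
    if y: "1 + y \<noteq> 0" "y * (y ^ 4 - 1) \<noteq> 0" for y
  proof -
    define z where "z = (1 - y) / (1 + y)"
    have z: "z * (1 + y) = 1 - y" using y by (simp add: z_def)
    have regroup: "u ^ (6 * e + 4) * (w ^ e * (a + b * z ^ 4)) = (u ^ 6 * w) ^ e * (a * u ^ 4 + b * (z * u) ^ 4)"
      for u w :: complex
      by (simp only: power_add power_mult power_mult_distrib) (simp add: algebra_simps)
    have term_eq: "coord_diff i j c * ((1 + y) ^ (CARD('n) - 1 - wt c) * (1 - y) ^ (wt c - 1))
        = (1 + y) ^ (CARD('n) - 2) * (coord_diff i j c * z ^ (wt c - 1))" for c :: "'a ^ 'n"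
    proof (cases "coord_diff i j c = 0")
      case False
      have "CARD('n) - 2 = (CARD('n) - 1 - wt c) + (wt c - 1)"
        using coord_diff_nonzero_wt[OF False] by simp
      then show ?thesis by (simp add: z[symmetric] power_add power_mult_distrib mult_ac)
    qed simp
    have "of_nat (card C) * poly (diff_enum i j) y
      = - 2 * ((1 + y) ^ (CARD('n) - 2) * (\<Sum>c\<in>C. coord_diff i j c * z ^ (wt c - 1)))"
      unfolding poly_diff_enum_macwilliams sum_distrib_left[of "(1 + y) ^ (CARD('n) - 2)"]
        term_eq[symmetric] using \<open>CARD('a) = 2\<close> by simp
    also have "(\<Sum>c\<in>C. coord_diff i j c * z ^ (wt c - 1)) = poly (diff_enum i j) z"
      by (simp add: diff_enum_def poly_sum poly_monom)
    also have "(1 + y) ^ (CARD('n) - 2) * poly (diff_enum i j) z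
      = (1 + y) ^ (6 * e + 4) * ((z * (z ^ 4 - 1)) ^ e * (a + b * z ^ 4))"
      by (simp add: s(2) ab len d mult.commute[of "z ^ 4" b] add.commute[of 4])
    also have "\<dots> = ((1 + y) ^ 6 * (z * (z ^ 4 - 1))) ^ e * (a * (1 + y) ^ 4 + b * (z * (1 + y)) ^ 4)"
      by (rule regroup)
    also have "(1 + y) ^ 6 * (z * (z ^ 4 - 1))
      = (1 + y) * (z * (1 + y)) * ((z * (1 + y)) ^ 4 - (1 + y) ^ 4)"
      by algebra
    also have "\<dots> = 8 * (y * (y ^ 4 - 1))"
      unfolding z by algebra
    finally have "(y * (y ^ 4 - 1)) ^ e * (of_nat (card C) * (a + b * y ^ 4))
      = (y * (y ^ 4 - 1)) ^ e * (- (2 * 8 ^ e) * (a * (1 + y) ^ 4 + b * (1 - y) ^ 4))"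
      by (simp only: s(2) ab z power_mult_distrib[of 8]) (simp add: mult_ac)
    then have "of_nat (card C) * (a + b * y ^ 4) = - (2 * 8 ^ e) * (a * (1 + y) ^ 4 + b * (1 - y) ^ 4)"
      by (simp only: mult_cancel_left power_eq_0_iff y(2) simp_thms)
    then show ?thesis using code_nonempty by (simp add: \<kappa>_def field_simps)
  qed
  \<comment> \<open>The left side is even in \<open>y\<close>, so \<open>2\<close> and \<open>-2\<close> give \<open>a = b\<close>; the values at \<open>2\<close> and \<open>3\<close>
    then ask for two different \<open>\<kappa>\<close>.\<close>
  have at2: "a + b * 16 = \<kappa> * (a * 81 + b)"
    using eq[of 2] by simp
  have at2': "a + b * 16 = \<kappa> * (a + b * 81)"
    using eq[of "-2"] by simp
  have at3: "a + b * 81 = \<kappa> * (a * 256 + b * 16)"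
    using eq[of 3] by simp
  have "\<kappa> * (80 * (a - b)) = 0"
    using at2 at2' by algebra
  then have ba: "b = a" using \<kappa> by simp
  have "a = 0"
  proof (rule ccontr)
    assume "a \<noteq> 0"
    have "a * (82 * \<kappa> - 17) = 0" and "a * (272 * \<kappa> - 82) = 0"
      using at2 at3 unfolding ba by algebra+
    with \<open>a \<noteq> 0\<close> have "82 * \<kappa> = 17" and "272 * \<kappa> = 82" by simp_all
    then have "\<kappa> = 17 / 82" by (simp add: eq_divide_eq mult.commute)
    with \<open>272 * \<kappa> = 82\<close> show False by simp
  qed
  then have "poly (diff_enum i j) = poly 0"
    by (auto simp: s(2) ab ba)
  then show ?thesis by (simp only: poly_eq_poly_eq_iff)
qed

text \<open>
  The coefficient of \<open>y ^ (d - 1)\<close> in \<open>diff_enum i j\<close> is the difference between the numbers of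
  weight-\<open>d\<close> words that are nonzero at \<open>i\<close> and at \<open>j\<close>. If all differences vanish, count the nonzero
  entries of the weight-\<open>d\<close> words by rows and by columns.
\<close>

lemma length_dvd_weighted_count:
  assumes "\<And>i j. diff_enum i j = 0" and "d > 0"
  shows "CARD('n) dvd d * card {c \<in> C. wt c = d}"
proof -
  define W where "W = {c \<in> C. wt c = d}"
  define N where "N i = (\<Sum>c\<in>W. of_bool (c $ i \<noteq> 0) :: nat)" for i
  have "N i = N j" for i j
  proof -
    have "0 = coeff (diff_enum i j) (d - 1)" by (simp add: assms(1))
    also have "\<dots> = (\<Sum>c\<in>C. if wt c - 1 = d - 1 then coord_diff i j c else 0)"
      unfolding diff_enum_def coeff_sum by (intro sum.cong) auto
    also have "\<dots> = (\<Sum>c\<in>C. if wt c = d then coord_diff i j c else 0)"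
    proof (intro sum.cong refl)
      fix c
      show "(if wt c - 1 = d - 1 then coord_diff i j c else 0) = (if wt c = d then coord_diff i j c else 0)"
        using coord_diff_nonzero_wt(1)[of i j c] \<open>d > 0\<close> by (cases "coord_diff i j c = 0") auto
    qed
    also have "\<dots> = (\<Sum>c\<in>W. coord_diff i j c)"
      unfolding W_def by (simp add: sum.If_cases Int_def)
    also have "\<dots> = of_nat (N i) - of_nat (N j)"
      by (simp add: N_def coord_diff_def sum_subtractf)
    finally show ?thesis by simp
  qed
  then obtain l where l: "\<And>i. N i = l" by metis
  have "CARD('n) * l = (\<Sum>i\<in>UNIV. N i)"
    by (simp add: l)
  also have "\<dots> = (\<Sum>c\<in>W. \<Sum>i\<in>UNIV. of_bool (c $ i \<noteq> 0))"
    unfolding N_def by (rule sum.swap)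
  also have "\<dots> = (\<Sum>c\<in>W. wt c)"
    by (simp add: wt_def)
  also have "\<dots> = d * card W"
    by (simp add: W_def)
  finally show ?thesis
    unfolding W_def by (metis dvd_triv_left)
qed

end

section \<open>Finite fields with two, three and four elements\<close>

lemma of_nat_card_eq_0: "of_nat CARD('a::{field,finite}) = (0::'a)"
proof -
  have "(\<Sum>x\<in>UNIV. x) = (\<Sum>x\<in>UNIV. x + 1 :: 'a)"
    by (rule sum.reindex_bij_witness[of _ "\<lambda>x. x + 1" "\<lambda>x. x - 1"]) auto
  then show ?thesis by (simp add: sum.distrib)
qed

lemma power_card_minus_1:
  fixes x :: "'a::{field,finite}"
  assumes "x \<noteq> 0"
  shows "x ^ (CARD('a) - 1) = 1"
proof -
  have "(\<Prod>y\<in>UNIV - {0}. y) = (\<Prod>y\<in>UNIV - {0}. x * y)"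
    by (rule prod.reindex_bij_witness[of _ "\<lambda>y. x * y" "\<lambda>y. y / x"]) (use assms in auto)
  also have "\<dots> = x ^ (CARD('a) - 1) * (\<Prod>y\<in>UNIV - {0}. y)"
    by (simp only: prod.distrib prod_constant card_Diff_singleton UNIV_I)
  finally show ?thesis by simp
qed

lemma of_nat_eq_0_iff_prime_dvd:
  assumes "prime p" and "of_nat p = (0 :: 'a::field)"
  shows "of_nat m = (0 :: 'a) \<longleftrightarrow> p dvd m"
proof -
  have "CHAR('a) dvd p"
    using assms(2) by (simp add: of_nat_eq_0_iff_char_dvd)
  moreover have "CHAR('a) \<noteq> 1"
    using of_nat_eq_0_iff_char_dvd[of 1, where 'a = 'a] by auto
  ultimately have "CHAR('a) = p"
    using assms(1) by (auto simp: prime_nat_iff)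
  then show ?thesis by (simp add: of_nat_eq_0_iff_char_dvd)
qed

text \<open>
  Every nonzero field element has \<open>r\<close>-th power \<open>1\<close>, so the inner product of a word with itself, or with
  the all-one word for \<open>q = 2\<close>, is its weight. Weights of self-orthogonal words are therefore divisible
  by the characteristic.
\<close>

lemma sum_power_eq_wt:
  fixes c :: "'a::{field,finite} ^ 'n"
  assumes "CARD('a) = Suc r" and "r > 0"
  shows "(\<Sum>i\<in>UNIV. (c $ i) ^ r) = of_nat (wt c)"
proof -
  have "(c $ i) ^ r = (if c $ i \<noteq> 0 then 1 else 0)" for i
    using power_card_minus_1[of "c $ i"] assms by auto
  then show ?thesis by (simp add: wt_def sum.If_cases)
qed

lemma two_eq_0_if_card_4:
  assumes "CARD('a::{field,finite}) = 4"
  shows "(2::'a) = 0"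
proof -
  have "(2::'a) * 2 = of_nat CARD('a)" by (simp add: assms)
  then show ?thesis by (simp only: of_nat_card_eq_0 mult_eq_0_iff disj_absorb)
qed

text \<open>
  The sign character of the quotient by an additive subgroup \<open>H\<close> of index two. It serves the fields
  of characteristic two, with \<open>H\<close> the trivial subgroup for \<open>q = 2\<close> and the prime field for
  \<open>q = 4\<close>.
\<close>

lemma index_two_character:
  fixes H :: "'a::{field,finite} set"
  assumes "0 \<in> H" and "H \<noteq> UNIV" and "\<And>a b. a + b \<in> H \<longleftrightarrow> (a \<in> H \<longleftrightarrow> b \<in> H)"
  obtains \<psi> :: "'a::{field,finite} \<Rightarrow> complex" where "\<psi> 0 = 1" "\<And>a b. \<psi> (a + b) = \<psi> a * \<psi> b" "\<exists>a. \<psi> a \<noteq> 1"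
proof (rule that[of "\<lambda>x. if x \<in> H then 1 else - 1"])
  show "\<exists>a. (if a \<in> H then 1 else - 1) \<noteq> (1::complex)"
    using assms(2) by auto
qed (use assms(1,3) in auto)

lemma binary_character:
  assumes "CARD('a::{field,finite}) = 2"
  obtains \<psi> :: "'a::{field,finite} \<Rightarrow> complex" where "\<psi> 0 = 1" "\<And>a b. \<psi> (a + b) = \<psi> a * \<psi> b" "\<exists>a. \<psi> a \<noteq> 1"
proof -
  have two: "(1::'a) + 1 = 0"
    using of_nat_card_eq_0[where 'a = 'a] assms by simp
  have univ: "(UNIV :: 'a set) = {0, 1}"
    by (rule card_subset_eq[symmetric]) (use assms in auto)
  have 01: "x = 0 \<or> x = 1" for x :: 'a
    using univ by auto
  have "a + b \<in> {0} \<longleftrightarrow> (a \<in> {0} \<longleftrightarrow> b \<in> {0})" for a b :: 'a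
    using 01[of a] 01[of b] two by auto
  then show ?thesis
    using index_two_character[of "{0 :: 'a}"] that by (auto simp: univ)
qed

lemma quaternary_character:
  assumes "CARD('a::{field,finite}) = 4"
  obtains \<psi> :: "'a::{field,finite} \<Rightarrow> complex" where "\<psi> 0 = 1" "\<And>a b. \<psi> (a + b) = \<psi> a * \<psi> b" "\<exists>a. \<psi> a \<noteq> 1"
proof -
  have two: "x + x = 0" for x :: 'a
    by (simp only: mult_2[symmetric] two_eq_0_if_card_4[OF assms] mult_zero_left)
  have "{0, 1} \<noteq> (UNIV :: 'a set)"
  proof
    assume "{0, 1} = (UNIV :: 'a set)"
    then have "CARD('a) = card {0, 1 :: 'a}" by simp
    with assms show False by simp
  qed
  then obtain a :: 'a where a: "a \<notin> {0, 1}" by blast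
  have "1 + a \<noteq> 0"
    using a two[of 1] by (metis add_left_cancel insertCI)
  then have a': "a \<noteq> 0" "a \<noteq> 1" "a + 1 \<noteq> 0" "1 + a \<noteq> 0"
    using a by (auto simp: add.commute)
  then have "card {0, 1, a, a + 1} = CARD('a)"
    using assms by simp
  then have "{0, 1, a, a + 1} = (UNIV :: 'a set)"
    by (intro card_subset_eq) auto
  then have four: "x = 0 \<or> x = 1 \<or> x = a \<or> x = a + 1" for x
    by auto
  have two': "x + (x + y) = y" for x y :: 'a
    by (simp only: two add.assoc[symmetric] add_0_left)
  have "x + y \<in> {0, 1} \<longleftrightarrow> (x \<in> {0, 1} \<longleftrightarrow> y \<in> {0, 1})" for x y :: 'a
    using four[of x] four[of y] by (elim disjE) (simp_all add: two two' a' add_ac)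
  moreover have "{0, 1} \<noteq> (UNIV :: 'a set)"
    using a by blast
  ultimately show ?thesis
    using index_two_character[of "{0, 1 :: 'a}"] that by blast
qed

lemma ternary_character:
  assumes "CARD('a::{field,finite}) = 3"
  obtains \<psi> :: "'a::{field,finite} \<Rightarrow> complex" where "\<psi> 0 = 1" "\<And>a b. \<psi> (a + b) = \<psi> a * \<psi> b" "\<exists>a. \<psi> a \<noteq> 1"
proof -
  have three: "(1::'a) + 1 + 1 = 0"
    using of_nat_card_eq_0[where 'a = 'a] assms by (simp add: numeral_3_eq_3 add_ac)
  then have sums: "(1::'a) + 1 = - 1" "- 1 + - 1 = (1::'a)"
    by (simp_all add: eq_neg_iff_add_eq_0 neg_eq_iff_add_eq_0 add_ac)
  have "(1::'a) \<noteq> - 1"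
    using sums by (metis add_left_cancel add.right_neutral one_neq_zero)
  then have "{0, 1, - 1} = (UNIV :: 'a set)"
    by (intro card_subset_eq) (use assms in auto)
  then have cases: "x = 0 \<or> x = 1 \<or> x = - 1" for x :: 'a
    by auto
  define \<omega> where "\<omega> = cis (2 * pi / 3)"
  have \<omega>3: "\<omega> * \<omega> * \<omega> = 1"
    by (simp add: \<omega>_def cis_mult)
  have "Re \<omega> = - 1 / 2" by (simp add: \<omega>_def cos_120)
  then have \<omega>1: "\<omega> \<noteq> 1" by auto
  show ?thesis
  proof (rule that[of "\<lambda>x. if x = 0 then 1 else if x = 1 then \<omega> else \<omega> * \<omega>"])
    fix a b :: 'a
    show "(if a + b = 0 then 1 else if a + b = 1 then \<omega> else \<omega> * \<omega>)
      = (if a = 0 then 1 else if a = 1 then \<omega> else \<omega> * \<omega>) * (if b = 0 then 1 else if b = 1 then \<omega> else \<omega> * \<omega>)"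
      using cases[of a] cases[of b] sums \<omega>3 \<open>1 \<noteq> - 1\<close> by (auto simp: mult_ac)
  qed (use \<omega>1 in \<open>auto intro!: exI[of _ 1]\<close>)
qed

section \<open>The number of words of minimum weight\<close>

lemma coeff_weight_enumerator:
  fixes C :: "('a::{zero,finite} ^ 'n) set"
  assumes "d \<le> CARD('n)"
  shows "coeff_xy (weight_enumerator C) (CARD('n) - d) d = int (card {c \<in> C. wt c = d})"
proof -
  have le: "wt c \<le> CARD('n)" for c :: "'a ^ 'n"
    unfolding wt_def by (rule card_mono) auto
  have y: "var_y ^ b = [:monom 1 b:]" for b
    by (induction b) (simp_all add: var_y_def mult_monom one_pCons monom_0)
  have "coeff (coeff (var_x ^ (CARD('n) - wt c) * var_y ^ wt c) (CARD('n) - d)) d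
      = (if wt c = d then 1 else 0)" for c :: "'a ^ 'n"
    using le[of c] assms by (auto simp: y var_x_def monom_power mult.commute[of _ "[:_:]"])
  then show ?thesis
    unfolding coeff_xy_def weight_enumerator_def by (simp add: coeff_sum sum.If_cases Int_def)
qed

lemma min_weight_le:
  fixes C :: "('a::{zero,finite} ^ 'n) set"
  assumes "c \<in> C" and "c \<noteq> 0"
  shows "min_weight C \<le> wt c"
  unfolding min_weight_def using assms by (intro Min_le) auto

lemma self_dual_imp_conjugate:
  fixes C :: "('a::{field,finite} ^ 'n) set"
  assumes "self_dual euclidean_prod C"
    and "\<psi> 0 = 1" "\<And>a b. \<psi> (a + b) = \<psi> a * \<psi> b" "\<exists>a. \<psi> a \<noteq> 1"
  shows "conjugate_self_dual_code C (\<lambda>x. x) \<psi>"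
proof
  show "C = dual_code (\<lambda>x y. \<Sum>i\<in>UNIV. x $ i * y $ i) C"
    using assms(1) unfolding self_dual_def euclidean_prod_def by blast
qed (use assms in \<open>auto simp: self_dual_def linear_code_def bij_def\<close>)

lemma hermitian_self_dual_imp_conjugate:
  fixes C :: "('a::{field,finite} ^ 'n) set"
  assumes "CARD('a) = 4" and "self_dual hermitian_prod C"
    and "\<psi> 0 = 1" "\<And>a b. \<psi> (a + b) = \<psi> a * \<psi> b" "\<exists>a. \<psi> a \<noteq> 1"
  shows "conjugate_self_dual_code C (\<lambda>x. x\<^sup>2) \<psi>"
proof
  show "C = dual_code (\<lambda>x y. \<Sum>i\<in>UNIV. x $ i * (y $ i)\<^sup>2) C"
    using assms(2) unfolding self_dual_def hermitian_prod_def by blast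
  show "(a + b)\<^sup>2 = a\<^sup>2 + b\<^sup>2" for a b :: 'a
    by (simp add: power2_sum two_eq_0_if_card_4[OF assms(1)])
  have pow4: "(x\<^sup>2)\<^sup>2 = x" for x :: 'a
    using power_card_minus_1[of x] assms(1)
    by (cases "x = 0") (simp_all add: power2_eq_square power3_eq_cube mult.assoc)
  show "bij (\<lambda>x :: 'a. x\<^sup>2)"
    by (rule o_bij[of "\<lambda>x. x\<^sup>2"]) (simp_all only: fun_eq_iff o_def id_def pow4 simp_thms)
qed (use assms in \<open>auto simp: self_dual_def linear_code_def power_mult_distrib\<close>)

lemma self_orthogonal:
  assumes "self_dual B C" and "c \<in> C"
  shows "B c c = 0"
  using assms unfolding self_dual_def dual_code_def by blast

text \<open>
  Since all weights are even, the all-one word is orthogonal to the code and hence belongs to it.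
  Complementing a word therefore stays in the code, which bounds the weights other than \<open>n\<close> by \<open>n - d\<close>.
\<close>

theorem binary_case:
  fixes C :: "('a::{field,finite} ^ 'n) set"
  assumes "m > 0" and q: "CARD('a) = 2" and n: "CARD('n) = 24 * m"
    and C: "self_dual euclidean_prod C" and even: "doubly_even C" and min: "min_weight C = 4 * m"
  shows "6 dvd card {c \<in> C. wt c = 4 * m}"
proof -
  obtain \<psi> :: "'a \<Rightarrow> complex"
    where \<psi>: "\<psi> 0 = 1" "\<And>a b. \<psi> (a + b) = \<psi> a * \<psi> b" "\<exists>a. \<psi> a \<noteq> 1"
    using binary_character[OF q] by blast
  interpret conjugate_self_dual_code C "\<lambda>x. x" \<psi>
    using C \<psi> by (rule self_dual_imp_conjugate)
  have two: "(2::'a) = 0"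
    using of_nat_card_eq_0[where 'a = 'a] q by simp
  have univ: "(UNIV :: 'a set) = {0, 1}"
    by (rule card_subset_eq[symmetric]) (use q in auto)
  then have 01: "x = 0 \<or> x = 1" for x :: 'a by auto
  have dvd: "4 dvd wt c" if "c \<in> C" for c
    using even that by (simp add: doubly_even_def)
  have "euclidean_prod 1 c = 0" if "c \<in> C" for c
  proof -
    have "euclidean_prod 1 c = of_nat (wt c)"
      using sum_power_eq_wt[of 1 c] q by (simp add: euclidean_prod_def)
    also have "wt c = 2 * (wt c div 2)"
      using dvd[OF that] by presburger
    finally show ?thesis by (simp add: two)
  qed
  then have ones: "1 \<in> C"
    using C unfolding self_dual_def dual_code_def by blast
  have complement: "wt (1 + c) = CARD('n) - wt c" for c :: "'a ^ 'n"
  proof -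
    have "1 + a \<noteq> 0 \<longleftrightarrow> a = 0" for a :: 'a
      using 01[of a] two by auto
    then have "{i. (1 + c) $ i \<noteq> 0} = UNIV - {i. c $ i \<noteq> 0}" by auto
    then show ?thesis by (simp add: wt_def card_Diff_subset)
  qed
  have "diff_enum i j = 0" for i j
  proof (rule binary_diff_enum_eq_0[where d = "4 * m"])
    fix c assume c: "c \<in> C" "c \<noteq> 0" "wt c < CARD('n)"
    have "1 + c \<in> C"
      using ones c(1) subspace vec.subspace_add by blast
    moreover have "1 + c \<noteq> 0"
    proof
      assume "1 + c = 0"
      then have "wt (1 + c) = 0" by (simp add: wt_def)
      with complement[of c] c(3) show False by simp
    qed
    ultimately have "4 * m \<le> CARD('n) - wt c"
      using min_weight_le min complement by metis
    then show "4 * m \<le> wt c \<and> wt c \<le> CARD('n) - 4 * m"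
      using min_weight_le[OF c(1,2)] min c(3) by simp
  qed (use \<open>m > 0\<close> n q dvd in auto)
  then have "CARD('n) dvd 4 * m * card {c \<in> C. wt c = 4 * m}"
    using \<open>m > 0\<close> by (intro length_dvd_weighted_count) auto
  then have "(4 * m) * 6 dvd (4 * m) * card {c \<in> C. wt c = 4 * m}"
    by (simp add: n mult_ac)
  then show ?thesis
    using \<open>m > 0\<close> by (subst (asm) nat_mult_dvd_cancel1) auto
qed

theorem ternary_case:
  fixes C :: "('a::{field,finite} ^ 'n) set"
  assumes "m > 0" and q: "CARD('a) = 3" and n: "CARD('n) = 12 * m"
    and C: "self_dual euclidean_prod C" and min: "min_weight C = 3 * m"
  shows "4 dvd card {c \<in> C. wt c = 3 * m}"
proof -
  obtain \<psi> :: "'a \<Rightarrow> complex"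
    where \<psi>: "\<psi> 0 = 1" "\<And>a b. \<psi> (a + b) = \<psi> a * \<psi> b" "\<exists>a. \<psi> a \<noteq> 1"
    using ternary_character[OF q] by blast
  interpret conjugate_self_dual_code C "\<lambda>x. x" \<psi>
    using C \<psi> by (rule self_dual_imp_conjugate)
  have "(of_nat 3 :: 'a) = 0"
    using of_nat_card_eq_0[where 'a = 'a] q by simp
  then have char: "(of_nat k :: 'a) = 0 \<longleftrightarrow> 3 dvd k" for k
    by (intro of_nat_eq_0_iff_prime_dvd) simp_all
  have dvd: "3 dvd wt c" if "c \<in> C" for c
    using self_orthogonal[OF C that] sum_power_eq_wt[of 2 c] q char
    by (simp add: euclidean_prod_def power2_eq_square)
  have "diff_enum i j = 0" for i j
    by (rule diff_enum_eq_0_if_length[where d = "3 * m" and k = 3])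
      (use \<open>m > 0\<close> n q dvd min min_weight_le[of _ C] in auto)
  then have "CARD('n) dvd 3 * m * card {c \<in> C. wt c = 3 * m}"
    using \<open>m > 0\<close> by (intro length_dvd_weighted_count) auto
  then have "(3 * m) * 4 dvd (3 * m) * card {c \<in> C. wt c = 3 * m}"
    by (simp add: n mult_ac)
  then show ?thesis
    using \<open>m > 0\<close> by (subst (asm) nat_mult_dvd_cancel1) auto
qed

theorem quaternary_case:
  fixes C :: "('a::{field,finite} ^ 'n) set"
  assumes "m > 0" and q: "CARD('a) = 4" and n: "CARD('n) = 6 * m"
    and C: "self_dual hermitian_prod C" and min: "min_weight C = 2 * m"
  shows "3 dvd card {c \<in> C. wt c = 2 * m}"
proof -
  obtain \<psi> :: "'a \<Rightarrow> complex"
    where \<psi>: "\<psi> 0 = 1" "\<And>a b. \<psi> (a + b) = \<psi> a * \<psi> b" "\<exists>a. \<psi> a \<noteq> 1"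
    using quaternary_character[OF q] by blast
  interpret conjugate_self_dual_code C "\<lambda>x. x\<^sup>2" \<psi>
    using q C \<psi> by (rule hermitian_self_dual_imp_conjugate)
  have char: "(of_nat k :: 'a) = 0 \<longleftrightarrow> 2 dvd k" for k
    by (intro of_nat_eq_0_iff_prime_dvd) (simp_all add: two_eq_0_if_card_4[OF q])
  have dvd: "2 dvd wt c" if "c \<in> C" for c
    using self_orthogonal[OF C that] sum_power_eq_wt[of 3 c] q char
    by (simp add: hermitian_prod_def power2_eq_square power3_eq_cube mult.assoc)
  have "diff_enum i j = 0" for i j
    by (rule diff_enum_eq_0_if_length[where d = "2 * m" and k = 2])
      (use \<open>m > 0\<close> n q dvd min min_weight_le[of _ C] in auto)
  then have "CARD('n) dvd 2 * m * card {c \<in> C. wt c = 2 * m}"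
    using \<open>m > 0\<close> by (intro length_dvd_weighted_count) auto
  then have "(2 * m) * 3 dvd (2 * m) * card {c \<in> C. wt c = 2 * m}"
    by (simp add: n mult_ac)
  then show ?thesis
    using \<open>m > 0\<close> by (subst (asm) nat_mult_dvd_cancel1) auto
qed

theorem corollary1p2:
  fixes m :: nat
    and C2 :: "('f2::{field,finite} ^ 'n2) set"
    and C3 :: "('f3::{field,finite} ^ 'n3) set"
    and C4 :: "('f4::{field,finite} ^ 'n4) set"
  assumes "m > 0"
  shows
    "(CARD('f2) = 2 \<and> CARD('n2) = 24 * m \<and>
        self_dual euclidean_prod C2 \<and> doubly_even C2 \<and> min_weight C2 = 4 * m
      \<longrightarrow> 6 dvd coeff_xy (weight_enumerator C2) (24 * m - 4 * m) (4 * m))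
   \<and> (CARD('f3) = 3 \<and> CARD('n3) = 12 * m \<and>
        self_dual euclidean_prod C3 \<and> min_weight C3 = 3 * m
      \<longrightarrow> 4 dvd coeff_xy (weight_enumerator C3) (12 * m - 3 * m) (3 * m))
   \<and> (CARD('f4) = 4 \<and> CARD('n4) = 6 * m \<and>
        self_dual hermitian_prod C4 \<and> min_weight C4 = 2 * m
      \<longrightarrow> 3 dvd coeff_xy (weight_enumerator C4) (6 * m - 2 * m) (2 * m))"
proof (intro conjI impI; elim conjE)
  assume *: "CARD('f2) = 2" "CARD('n2) = 24 * m" "self_dual euclidean_prod C2" "doubly_even C2"
    "min_weight C2 = 4 * m"
  have "int 6 dvd int (card {c \<in> C2. wt c = 4 * m})"
    unfolding int_dvd_int_iff by (rule binary_case[OF \<open>m > 0\<close> *])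
  then show "6 dvd coeff_xy (weight_enumerator C2) (24 * m - 4 * m) (4 * m)"
    using coeff_weight_enumerator[of "4 * m" C2] *(2) by simp
next
  assume *: "CARD('f3) = 3" "CARD('n3) = 12 * m" "self_dual euclidean_prod C3"
    "min_weight C3 = 3 * m"
  have "int 4 dvd int (card {c \<in> C3. wt c = 3 * m})"
    unfolding int_dvd_int_iff by (rule ternary_case[OF \<open>m > 0\<close> *])
  then show "4 dvd coeff_xy (weight_enumerator C3) (12 * m - 3 * m) (3 * m)"
    using coeff_weight_enumerator[of "3 * m" C3] *(2) by simp
next
  assume *: "CARD('f4) = 4" "CARD('n4) = 6 * m" "self_dual hermitian_prod C4"
    "min_weight C4 = 2 * m"
  have "int 3 dvd int (card {c \<in> C4. wt c = 2 * m})"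
    unfolding int_dvd_int_iff by (rule quaternary_case[OF \<open>m > 0\<close> *])
  then show "3 dvd coeff_xy (weight_enumerator C4) (6 * m - 2 * m) (2 * m)"
    using coeff_weight_enumerator[of "2 * m" C4] *(2) by simp
qed

end
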